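(* Let $n\ge1$. On the ring $\mathbb{Q}[z_1,\dots,z_n,\overline z_1,\dots,\overline z_n]^{S_n}$ of bisymmetric functions, the Poisson brackets among the multiplicative generators $\tau_{(j,k)}$ ($0\le j\le n$, $0\le k\le n$, $1\le j+k\le n$) are given by $$\frac{i}{2}\{\tau_{(j_1,k_1)},\tau_{(j_2,k_2)}\}=(j_1k_2-j_2k_1)\,\tau_{(j_1+j_2,\,k_1+k_2)},$$ where, when $j_1+j_2+k_1+k_2>n$, the right-hand side is to be rewritten as a polynomial in the generators $\tau_{(j,k)}$ with $0\le j\le n$, $0\le k\le n$, $1\le j+k\le n$.
   Context: $S_n$ permutes the variables $z_1,\dots,z_n$ and the variables $\overline z_1,\dots,\overline z_n$ simultaneously (diagonal action). For $r,s\ge0$, $r+s\ge1$, the bisymmetric power sum function is $\tau_{(r,s)}=\sum_{j=1}^n z_j^r\,\overline z_j^{\,s}$; those with $1\le r+s\le n$ generate the ring of bisymmetric functions (classical). Poisson structure: $z_1,\dots,z_n$ are the coordinates on the diagonal maximal torus $T^{\mathbb{C}}=(\mathbb{C}^* )^n$ of $\mathrm{GL}(n,\mathbb{C})=\mathrm{U}(n)^{\mathbb{C}}$. With the Kähler potential coming from the quadratic form $(it_1,\dots,it_n)\mapsto t_1^2+\dots+t_n^2$ on the Lie algebra of the standard maximal torus of $\mathrm{U}(n)$, i.e. $\kappa=\sum_j\log^2|z_j|$ with symplectic form $i\partial\overline\partial\kappa$, the Poisson bracket is determined by $$\tfrac{i}{2}\{z_j,\overline z_k\}=\delta_{jk}\,z_j\overline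 z_j,\qquad \{z_j,z_k\}=0=\{\overline z_j,\overline z_k\}\qquad(1\le j,k\le n),$$ complex bilinearity and the derivation property. *)

theory Defs
  imports Complex_Main "HOL-Library.Cardinality" "HOL-Library.Poly_Mapping"
begin

text \<open>
  A polynomial with coefficients in \<open>'c\<close> and variables \<open>'v\<close> is a finitely supported
  function from exponent vectors to coefficients; multiplication is convolution.
\<close>

type_synonym ('v, 'c) polynomial = "('v \<Rightarrow>\<^sub>0 nat) \<Rightarrow>\<^sub>0 'c"

definition scalar :: "'c::zero \<Rightarrow> ('v, 'c) polynomial" where
  "scalar c = Poly_Mapping.single 0 c"

definition variable :: "'v \<Rightarrow> ('v, 'c::zero_neq_one) polynomial" where
  "variable v = Poly_Mapping.single (Poly_Mapping.single v 1) 1"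

text \<open>
  \<open>substitute h x p\<close> replaces every variable \<open>v\<close> of \<open>p\<close> by \<open>x v\<close> and every
  coefficient \<open>c\<close> by \<open>h c\<close>.
\<close>

definition substitute ::
    "('c::zero \<Rightarrow> 'r::comm_semiring_1) \<Rightarrow> ('v \<Rightarrow> 'r) \<Rightarrow> ('v, 'c) polynomial \<Rightarrow> 'r" where
  "substitute h x p =
    (\<Sum>m\<in>Poly_Mapping.keys p. h (Poly_Mapping.lookup p m) *
      (\<Prod>v\<in>Poly_Mapping.keys m. x v ^ Poly_Mapping.lookup m v))"

definition indets :: "('v, 'c::zero) polynomial \<Rightarrow> 'v set" where
  "indets p = (\<Union>m\<in>Poly_Mapping.keys p. Poly_Mapping.keys m)"

text \<open>
  The number \<open>n \<ge> 1\<close> of pairs of variables is \<open>CARD('n)\<close> for a finite index type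
  \<open>'n\<close>. \<open>Z j\<close> and \<open>Zbar j\<close> name the two variables of index \<open>j\<close>. The bracket of two
  polynomials with rational coefficients involves the imaginary unit, so everything takes
  place in the polynomial ring over the complex numbers.
\<close>

datatype 'n bivariable = Z 'n | Zbar 'n

type_synonym 'n bipolynomial = "('n bivariable, complex) polynomial"

abbreviation z :: "'n \<Rightarrow> 'n bipolynomial" where
  "z j \<equiv> variable (Z j)"

abbreviation zbar :: "'n \<Rightarrow> 'n bipolynomial" where
  "zbar j \<equiv> variable (Zbar j)"

definition diagonal_action :: "('n \<Rightarrow> 'n) \<Rightarrow> 'n bipolynomial \<Rightarrow> 'n bipolynomial" where
  "diagonal_action \<sigma> = substitute scalar (case_bivariable (\<lambda>j. z (\<sigma> j)) (\<lambda>j. zbar (\<sigma> j)))"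

text \<open>
  The ring of bisymmetric functions, viewed inside the complex polynomial ring as the
  invariant polynomials all of whose coefficients are rational.
\<close>

definition bisymmetric :: "'n::finite bipolynomial set" where
  "bisymmetric =
    {p. (\<forall>m. Poly_Mapping.lookup p m \<in> \<rat>) \<and> (\<forall>\<sigma>. bij \<sigma> \<longrightarrow> diagonal_action \<sigma> p = p)}"

definition power_sum :: "nat \<times> nat \<Rightarrow> 'n::finite bipolynomial" (\<open>\<tau>\<close>) where
  "\<tau> = (\<lambda>(r, s). \<Sum>j\<in>UNIV. z j ^ r * zbar j ^ s)"

definition generator_indices :: "nat \<Rightarrow> (nat \<times> nat) set" where
  "generator_indices n = {(j, k). j \<le> n \<and> k \<le> n \<and> 1 \<le> j + k \<and> j + k \<le> n}"

definition polynomial_in_generators :: "'n::finite bipolynomial \<Rightarrow> bool" where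
  "polynomial_in_generators p \<longleftrightarrow>
    (\<exists>F :: (nat \<times> nat, rat) polynomial.
      indets F \<subseteq> generator_indices CARD('n) \<and>
      p = substitute (\<lambda>c. scalar (of_rat c)) \<tau> F)"

definition poisson_bracket :: "(('v, complex) polynomial \<Rightarrow> ('v, complex) polynomial \<Rightarrow>
    ('v, complex) polynomial) \<Rightarrow> bool" where
  "poisson_bracket br \<longleftrightarrow>
    (\<forall>p q r. br (p + q) r = br p r + br q r) \<and>
    (\<forall>c p q. br (scalar c * p) q = scalar c * br p q) \<and>
    (\<forall>p q. br p q = - br q p) \<and>
    (\<forall>p q r. br p (q * r) = br p q * r + q * br p r) \<and>
    (\<forall>p q r. br p (br q r) + br q (br r p) + br r (br p q) = 0)"

definition torus_poisson_bracket ::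
    "('n bipolynomial \<Rightarrow> 'n bipolynomial \<Rightarrow> 'n bipolynomial) \<Rightarrow> bool" where
  "torus_poisson_bracket br \<longleftrightarrow>
    poisson_bracket br \<and>
    (\<forall>j k. scalar (\<i> / 2) * br (z j) (zbar k) = (if j = k then z j * zbar j else 0)) \<and>
    (\<forall>j k. br (z j) (z k) = 0) \<and>
    (\<forall>j k. br (zbar j) (zbar k) = 0)"

text \<open>
  Such a bracket exists: on monomials it multiplies the product by a bilinear function of
  the exponent vectors.
\<close>

definition exponent_pairing ::
    "('n::finite bivariable \<Rightarrow>\<^sub>0 nat) \<Rightarrow> ('n bivariable \<Rightarrow>\<^sub>0 nat) \<Rightarrow> complex" where
  "exponent_pairing a b =
    (\<Sum>j\<in>UNIV. of_nat (Poly_Mapping.lookup a (Z j)) * of_nat (Poly_Mapping.lookup b (Zbar j))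
       - of_nat (Poly_Mapping.lookup a (Zbar j)) * of_nat (Poly_Mapping.lookup b (Z j)))"

definition log_canonical_bracket ::
    "'n::finite bipolynomial \<Rightarrow> 'n bipolynomial \<Rightarrow> 'n bipolynomial" where
  "log_canonical_bracket p q =
    (\<Sum>a\<in>Poly_Mapping.keys p. \<Sum>b\<in>Poly_Mapping.keys q. Poly_Mapping.single (a + b)
       (- 2 * \<i> * exponent_pairing a b * Poly_Mapping.lookup p a * Poly_Mapping.lookup q b))"

lemma exponent_pairing_swap: "exponent_pairing a b = - exponent_pairing b a"
  unfolding exponent_pairing_def sum_negf[symmetric]
  by (rule sum.cong) (auto simp: algebra_simps)

lemma exponent_pairing_add_right:
  "exponent_pairing a (b + c) = exponent_pairing a b + exponent_pairing a c"
  unfolding exponent_pairing_def sum.distrib[symmetric]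
  by (rule sum.cong) (auto simp: algebra_simps lookup_add)

lemma log_canonical_bracket_superset:
  assumes "finite A" "finite B" "Poly_Mapping.keys p \<subseteq> A" "Poly_Mapping.keys q \<subseteq> B"
  shows "log_canonical_bracket p q =
    (\<Sum>a\<in>A. \<Sum>b\<in>B. Poly_Mapping.single (a + b)
       (- 2 * \<i> * exponent_pairing a b * Poly_Mapping.lookup p a * Poly_Mapping.lookup q b))"
proof -
  have inner: "(\<Sum>b\<in>Poly_Mapping.keys q. Poly_Mapping.single (a + b)
       (- 2 * \<i> * exponent_pairing a b * Poly_Mapping.lookup p a * Poly_Mapping.lookup q b)) =
     (\<Sum>b\<in>B. Poly_Mapping.single (a + b)
       (- 2 * \<i> * exponent_pairing a b * Poly_Mapping.lookup p a * Poly_Mapping.lookup q b))" for a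
    by (rule sum.mono_neutral_left) (use assms in \<open>auto simp: in_keys_iff\<close>)
  show ?thesis
    unfolding log_canonical_bracket_def inner
    by (rule sum.mono_neutral_left) (use assms in \<open>auto simp: in_keys_iff\<close>)
qed

lemma log_canonical_bracket_single:
  "log_canonical_bracket (Poly_Mapping.single a c) (Poly_Mapping.single b d) =
    Poly_Mapping.single (a + b) (- 2 * \<i> * exponent_pairing a b * c * d)"
  by (subst log_canonical_bracket_superset[where A = "{a}" and B = "{b}"]) auto

lemma log_canonical_bracket_swap: "log_canonical_bracket p q = - log_canonical_bracket q p"
proof -
  have "log_canonical_bracket p q =
      (\<Sum>b\<in>Poly_Mapping.keys q. \<Sum>a\<in>Poly_Mapping.keys p. Poly_Mapping.single (a + b)
       (- 2 * \<i> * exponent_pairing a b * Poly_Mapping.lookup p a * Poly_Mapping.lookup q b))"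
    unfolding log_canonical_bracket_def by (rule sum.swap)
  also have "\<dots> = - log_canonical_bracket q p"
    unfolding log_canonical_bracket_def sum_negf[symmetric]
  proof (intro sum.cong refl)
    fix a b
    show "Poly_Mapping.single (a + b)
       (- 2 * \<i> * exponent_pairing a b * Poly_Mapping.lookup p a * Poly_Mapping.lookup q b) =
      - Poly_Mapping.single (b + a)
       (- 2 * \<i> * exponent_pairing b a * Poly_Mapping.lookup q b * Poly_Mapping.lookup p a)"
      by (subst exponent_pairing_swap) (simp add: single_uminus[symmetric] algebra_simps)
  qed
  finally show ?thesis .
qed

lemma log_canonical_bracket_add_left:
  "log_canonical_bracket (p + q) r = log_canonical_bracket p r + log_canonical_bracket q r"
proof -
  let ?A = "Poly_Mapping.keys p \<union> Poly_Mapping.keys q" and ?B = "Poly_Mapping.keys r"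
  have "Poly_Mapping.keys (p + q) \<subseteq> ?A"
    by (rule keys_add)
  then show ?thesis
    by (simp add: log_canonical_bracket_superset[of ?A ?B] lookup_add sum.distrib[symmetric]
        single_add[symmetric] algebra_simps)
qed

lemma log_canonical_bracket_add_right:
  "log_canonical_bracket p (q + r) = log_canonical_bracket p q + log_canonical_bracket p r"
  using log_canonical_bracket_add_left[of q r p]
  by (simp add: log_canonical_bracket_swap[of p])

lemma polynomial_additive_induct:
  fixes p :: "('v, 'c::comm_ring_1) polynomial"
  assumes "\<And>a c. P (Poly_Mapping.single a c)" "\<And>p q. P p \<Longrightarrow> P q \<Longrightarrow> P (p + q)"
  shows "P p"
proof (induct p rule: update_induct)
  case const
  then show ?case using assms(1)[of 0 0] by simp
next
  case (update f a b)
  then have "Poly_Mapping.update a b f = f + Poly_Mapping.single a b"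
    by (intro poly_mapping_eqI)
       (auto simp: lookup_update lookup_add lookup_single in_keys_iff when_def)
  with update assms show ?case by metis
qed

lemma log_canonical_bracket_scalar:
  "log_canonical_bracket (scalar c * p) q = scalar c * log_canonical_bracket p q"
proof (induct p rule: polynomial_additive_induct)
  case (1 a d)
  show ?case
    by (induct q rule: polynomial_additive_induct)
       (simp_all add: scalar_def mult_single log_canonical_bracket_single
          log_canonical_bracket_add_right algebra_simps)
qed (simp add: log_canonical_bracket_add_left algebra_simps)

lemma log_canonical_bracket_derivation:
  "log_canonical_bracket p (q * r) =
     log_canonical_bracket p q * r + q * log_canonical_bracket p r"
proof (induct p rule: polynomial_additive_induct)
  case p: (1 a c)
  show ?case
  proof (induct q rule: polynomial_additive_induct)
    case q: (1 b d)
    show ?case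
      by (induct r rule: polynomial_additive_induct)
         (simp_all add: mult_single log_canonical_bracket_single exponent_pairing_add_right
            log_canonical_bracket_add_right single_add[symmetric] algebra_simps)
  qed (simp add: log_canonical_bracket_add_right algebra_simps)
qed (simp add: log_canonical_bracket_add_left algebra_simps)

lemma log_canonical_bracket_jacobi:
  "log_canonical_bracket p (log_canonical_bracket q r) +
   log_canonical_bracket q (log_canonical_bracket r p) +
   log_canonical_bracket r (log_canonical_bracket p q) = 0"
proof (induct p rule: polynomial_additive_induct)
  case p: (1 a c)
  show ?case
  proof (induct q rule: polynomial_additive_induct)
    case q: (1 b d)
    show ?case
    proof (induct r rule: polynomial_additive_induct)
      case r: (1 e f)
      show ?case
        by (simp add: log_canonical_bracket_single exponent_pairing_add_right
            single_add[symmetric] exponent_pairing_swap[of b a] exponent_pairing_swap[of e a]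
            exponent_pairing_swap[of e b] algebra_simps)
    qed (simp add: log_canonical_bracket_add_left log_canonical_bracket_add_right algebra_simps
           add_eq_0_iff)
  qed (simp add: log_canonical_bracket_add_left log_canonical_bracket_add_right algebra_simps
           add_eq_0_iff)
qed (simp add: log_canonical_bracket_add_left log_canonical_bracket_add_right algebra_simps
           add_eq_0_iff)

lemma torus_poisson_bracket_exists:
  "torus_poisson_bracket (log_canonical_bracket :: 'n::finite bipolynomial \<Rightarrow> _)"
proof -
  have pairing:
    "exponent_pairing (Poly_Mapping.single (Z j) 1) (Poly_Mapping.single (Zbar k) 1) = of_bool (j = k)"
    "exponent_pairing (Poly_Mapping.single (Z j) 1) (Poly_Mapping.single (Z k) 1) = 0"
    "exponent_pairing (Poly_Mapping.single (Zbar j) 1) (Poly_Mapping.single (Zbar k) 1) = 0"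
    for j k :: 'n
    by (simp_all add: exponent_pairing_def lookup_single when_def if_distrib[of of_nat]
        if_distrib[of "\<lambda>x. x * _"] cong: if_cong)
  show ?thesis
    unfolding torus_poisson_bracket_def poisson_bracket_def
    by (intro conjI allI log_canonical_bracket_add_left log_canonical_bracket_scalar
        log_canonical_bracket_swap log_canonical_bracket_derivation log_canonical_bracket_jacobi)
       (simp_all add: variable_def scalar_def log_canonical_bracket_single pairing mult_single
         del: One_nat_def)
qed

end

theory Submission
  imports Defs "HOL-Library.Product_Plus"
begin

text \<open>
  \<^bold>\<open>The bracket.\<close> In each argument the bracket is a derivation, and on the variables it is
  logarithmic: bracketing with a variable multiplies any variable by a ring element. A derivation
  that multiplies \<open>x\<close> by \<open>c\<close> and \<open>y\<close> by \<open>d\<close> multiplies \<open>x ^ r * y ^ s\<close> by \<open>r c + s d\<close>. Applying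
  this in one argument and then in the other (\<open>derivation_pair_monomial\<close>) evaluates the
  bracket of two monomials, each in one pair of variables; only pairs with the same index
  contribute, and the sum over the index is the bracket of two power sums.

  \<^bold>\<open>The generators.\<close> Write \<open>w e j\<close> for the monomial with exponent pair \<open>e\<close> in the variables of
  index \<open>j\<close>. For exponent pairs \<open>e\<^sub>1, \<dots>, e\<^sub>k\<close> consider the sum of \<open>\<Prod>i. w e\<^sub>i y\<^sub>i\<close> over all injective
  choices of indices \<open>y\<^sub>1, \<dots>, y\<^sub>k\<close>. Dropping the condition that \<open>y\<^sub>1\<close> avoids the other indices
  produces a factor \<open>\<tau> e\<^sub>1\<close>; the terms to subtract are those with \<open>y\<^sub>1 = y\<^sub>i\<close>, in which \<open>e\<^sub>1\<close> merges
  into \<open>e\<^sub>i\<close> because \<open>w\<close> is multiplicative in the exponent. This recursion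
  (\<open>injective_sum_Cons\<close>) has two consequences.

  First, every such sum is a polynomial in the \<open>\<tau> e\<close>. Averaging an invariant polynomial over all
  permutations writes it as a combination of such sums with \<open>k = n\<close>, so all the \<open>\<tau> e\<close> together
  generate (\<open>bisymmetric_in_subalgebra\<close>).

  Second, if no \<open>e\<^sub>i\<close> is zero, keeping track of the term in which everything is merged, the sum equals
  \<open>(-1) ^ (k - 1) * (k - 1)! * \<tau> (e\<^sub>1 + \<dots> + e\<^sub>k)\<close> plus a polynomial in power sums of smaller degree
  (\<open>injective_sum_leading_term\<close>). For \<open>k = n + 1\<close> there are no injective choices and the sum
  is \<open>0\<close>. An exponent pair of degree greater than \<open>n\<close> is a sum of \<open>n + 1\<close> nonzero ones, and \<open>n!\<close>
  is invertible in \<open>\<rat>\<close>; so its power sum is a polynomial in power sums of smaller degree, and by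
  induction in those of degree at most \<open>n\<close> (\<open>all_power_sums_in_subalgebra\<close>).
\<close>

section \<open>Substitution as a ring homomorphism\<close>

definition eval_monomial :: "('v \<Rightarrow> 'r::comm_semiring_1) \<Rightarrow> ('v \<Rightarrow>\<^sub>0 nat) \<Rightarrow> 'r" where
  "eval_monomial x m = (\<Prod>v\<in>Poly_Mapping.keys m. x v ^ Poly_Mapping.lookup m v)"

lemma eval_monomial_superset:
  assumes "finite A" "Poly_Mapping.keys m \<subseteq> A"
  shows "eval_monomial x m = (\<Prod>v\<in>A. x v ^ Poly_Mapping.lookup m v)"
  unfolding eval_monomial_def
  by (rule prod.mono_neutral_left) (use assms in \<open>auto simp: in_keys_iff\<close>)

lemma eval_monomial_add: "eval_monomial x (a + b) = eval_monomial x a * eval_monomial x b"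
proof -
  let ?A = "Poly_Mapping.keys a \<union> Poly_Mapping.keys b"
  have "Poly_Mapping.keys (a + b) \<subseteq> ?A"
    by (rule keys_add)
  then show ?thesis
    by (simp add: eval_monomial_superset[of ?A] lookup_add power_add prod.distrib)
qed

lemma polynomial_as_sum_of_monomials:
  fixes p :: "('v, 'c::comm_ring_1) polynomial"
  shows "p = (\<Sum>m\<in>Poly_Mapping.keys p. Poly_Mapping.single m (Poly_Mapping.lookup p m))"
  by (rule poly_mapping_eqI) (auto simp: lookup_sum lookup_single when_def in_keys_iff)

locale coefficient_hom =
  fixes h :: "'c::comm_ring_1 \<Rightarrow> 'r::comm_ring_1"
  assumes hom_zero: "h 0 = 0" and hom_one: "h 1 = 1"
    and hom_add: "h (a + b) = h a + h b" and hom_mult: "h (a * b) = h a * h b"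
begin

lemma substitute_superset:
  assumes "finite A" "Poly_Mapping.keys p \<subseteq> A"
  shows "substitute h x p = (\<Sum>m\<in>A. h (Poly_Mapping.lookup p m) * eval_monomial x m)"
  unfolding substitute_def eval_monomial_def
  by (rule sum.mono_neutral_left) (use assms in \<open>auto simp: in_keys_iff hom_zero\<close>)

lemma substitute_single: "substitute h x (Poly_Mapping.single m c) = h c * eval_monomial x m"
  by (subst substitute_superset[of "{m}"]) auto

lemma substitute_add: "substitute h x (p + q) = substitute h x p + substitute h x q"
proof -
  let ?A = "Poly_Mapping.keys p \<union> Poly_Mapping.keys q"
  have "Poly_Mapping.keys (p + q) \<subseteq> ?A"
    by (rule keys_add)
  then show ?thesis
    by (simp add: substitute_superset[of ?A] lookup_add hom_add distrib_right sum.distrib)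
qed

lemma substitute_mult: "substitute h x (p * q) = substitute h x p * substitute h x q"
proof (induct p rule: polynomial_additive_induct)
  case (1 a c)
  show ?case
    by (induct q rule: polynomial_additive_induct)
       (simp_all add: mult_single substitute_single substitute_add eval_monomial_add hom_mult
          algebra_simps)
qed (simp add: substitute_add algebra_simps)

lemma substitute_scalar: "substitute h x (scalar c) = h c"
  by (simp add: scalar_def substitute_single eval_monomial_def)

lemma substitute_variable: "substitute h x (variable v) = x v"
  by (simp add: variable_def substitute_single eval_monomial_def hom_one)

lemma substitute_power: "substitute h x (p ^ k) = substitute h x p ^ k"
  using substitute_scalar[of x 1]
  by (induct k) (simp_all add: substitute_mult hom_one scalar_def)

lemma substitute_sum: "substitute h x (\<Sum>i\<in>I. p i) = (\<Sum>i\<in>I. substitute h x (p i))"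
  by (induct I rule: infinite_finite_induct) (simp_all add: substitute_add, simp_all add: substitute_def)

end

lemma scalar_add: "scalar (a + b) = scalar a + scalar b"
  by (simp add: scalar_def single_add)

lemma scalar_mult: "scalar (a * b) = (scalar a * scalar b :: ('v, 'c::comm_ring_1) polynomial)"
  by (simp add: scalar_def mult_single)

lemma scalar_one: "scalar 1 = 1"
  by (simp add: scalar_def)

lemma scalar_of_nat: "scalar (of_nat k) = (of_nat k :: ('v, 'c::comm_ring_1) polynomial)"
  by (simp add: scalar_def single_of_nat)

lemma coefficient_hom_scalar: "coefficient_hom (scalar :: complex \<Rightarrow> ('v, complex) polynomial)"
  by unfold_locales (simp_all add: scalar_add scalar_mult scalar_one, simp add: scalar_def)

lemma coefficient_hom_scalar_of_rat:
  "coefficient_hom (\<lambda>c. scalar (of_rat c) :: ('v, complex) polynomial)"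
  by unfold_locales (simp_all add: of_rat_add of_rat_mult scalar_add scalar_mult scalar_one,
      simp add: scalar_def)

section \<open>Rational subalgebras of a complex polynomial ring\<close>

text \<open>
  The bisymmetric functions and the polynomials in the generators are both instances. Membership
  of a particular polynomial in the latter is shown for an arbitrary instance that contains the
  relevant power sums, without exhibiting a polynomial expression.
\<close>

definition rational_subalgebra :: "('v, complex) polynomial set \<Rightarrow> bool" where
  "rational_subalgebra G \<longleftrightarrow> (\<forall>c. scalar (of_rat c) \<in> G) \<and>
    (\<forall>p\<in>G. \<forall>q\<in>G. p + q \<in> G \<and> p * q \<in> G)"

context
  fixes G :: "('v, complex) polynomial set"
  assumes G: "rational_subalgebra G"
begin

lemma subalgebra_scalar: "scalar (of_rat c) \<in> G"
  and subalgebra_add: "p \<in> G \<Longrightarrow> q \<in> G \<Longrightarrow> p + q \<in> G"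
  and subalgebra_mult: "p \<in> G \<Longrightarrow> q \<in> G \<Longrightarrow> p * q \<in> G"
  using G by (auto simp: rational_subalgebra_def)

lemma subalgebra_of_int: "of_int k \<in> G"
proof -
  have "of_int k = (scalar (of_rat (of_int k)) :: ('v, complex) polynomial)"
    by (simp add: scalar_def)
  then show ?thesis
    by (simp only: subalgebra_scalar)
qed

lemma subalgebra_zero: "0 \<in> G" and subalgebra_one: "1 \<in> G"
  using subalgebra_of_int[of 0] subalgebra_of_int[of 1] by simp_all

lemma subalgebra_of_nat: "of_nat k \<in> G"
  using subalgebra_of_int[of "int k"] by simp

lemma subalgebra_diff: "p \<in> G \<Longrightarrow> q \<in> G \<Longrightarrow> p - q \<in> G"
  using subalgebra_add[of p "of_int (-1) * q"] subalgebra_mult[OF subalgebra_of_int[of "-1"], of q]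
  by simp

lemma subalgebra_sum: "(\<And>i. i \<in> I \<Longrightarrow> p i \<in> G) \<Longrightarrow> (\<Sum>i\<in>I. p i) \<in> G"
  by (induct I rule: infinite_finite_induct) (auto simp: subalgebra_zero subalgebra_add)

lemma subalgebra_prod: "(\<And>i. i \<in> I \<Longrightarrow> p i \<in> G) \<Longrightarrow> (\<Prod>i\<in>I. p i) \<in> G"
  by (induct I rule: infinite_finite_induct) (auto simp: subalgebra_one subalgebra_mult)

lemma subalgebra_power: "p \<in> G \<Longrightarrow> p ^ k \<in> G"
  by (induct k) (auto simp: subalgebra_one subalgebra_mult)

lemma subalgebra_divide:
  assumes "of_nat k * p \<in> G" "k \<noteq> 0"
  shows "p \<in> G"
proof -
  have "scalar (of_rat (1 / of_nat k)) * (of_nat k * p) = p"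
    using assms(2)
    by (simp add: mult.assoc[symmetric] scalar_of_nat[symmetric] scalar_mult[symmetric]
        of_rat_divide scalar_one)
  then show ?thesis
    using subalgebra_mult[OF subalgebra_scalar assms(1)] by metis
qed

lemma substitute_in_subalgebra:
  assumes "\<And>v. v \<in> indets F \<Longrightarrow> x v \<in> G"
  shows "substitute (\<lambda>c. scalar (of_rat c)) x F \<in> G"
  unfolding substitute_def
  by (intro subalgebra_sum subalgebra_mult subalgebra_scalar subalgebra_prod subalgebra_power assms)
     (auto simp: indets_def)

end

section \<open>Sums over injective assignments\<close>

text \<open>
  An injective assignment of indices to the members of a list is represented by the distinct list
  of its values, so that the recursion on the list of exponents is a recursion on lists of indices.
\<close>

definition weight_product :: "('e \<Rightarrow> 'i \<Rightarrow> 'r::comm_ring_1) \<Rightarrow> 'e list \<Rightarrow> 'i list \<Rightarrow> 'r" where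
  "weight_product w es ys = (\<Prod>i<length es. w (es ! i) (ys ! i))"

definition injective_sum :: "('e \<Rightarrow> 'i::finite \<Rightarrow> 'r::comm_ring_1) \<Rightarrow> 'e list \<Rightarrow> 'r" where
  "injective_sum w es = (\<Sum>ys | distinct ys \<and> length ys = length es. weight_product w es ys)"

lemma finite_distinct_lists: "finite {ys :: 'i::finite list. distinct ys \<and> length ys = k}"
  by (rule finite_subset[OF _ finite_lists_length_eq[of UNIV k]]) auto

lemma injective_sum_Nil: "injective_sum (w :: 'e \<Rightarrow> 'i::finite \<Rightarrow> 'r::comm_ring_1) [] = 1"
proof -
  have "{ys :: 'i list. ys = [] \<and> distinct ys} = {[]}"
    by auto
  then show ?thesis
    by (simp add: injective_sum_def weight_product_def)
qed

lemma injective_sum_too_long: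
  fixes w :: "'e \<Rightarrow> 'i::finite \<Rightarrow> 'r::comm_ring_1"
  assumes "CARD('i) < length es"
  shows "injective_sum w es = 0"
proof -
  have "length ys \<noteq> length es" if "distinct ys" for ys :: "'i list"
    using assms that card_mono[OF finite subset_UNIV, of "set ys"] by (simp add: distinct_card)
  then have "{ys :: 'i list. distinct ys \<and> length ys = length es} = {}"
    by auto
  then show ?thesis
    unfolding injective_sum_def by (simp only: sum.empty)
qed

text \<open>
  If the index of a further factor with exponent \<open>e\<close> coincides with the index at position \<open>i\<close>,
  the two factors combine into one.
\<close>

lemma weight_product_merge:
  fixes w :: "'e::comm_monoid_add \<Rightarrow> 'i \<Rightarrow> 'r::comm_ring_1"
  assumes "\<And>e f y. w (e + f) y = w e y * w f y" and "i < length es"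
  shows "weight_product w (es[i := e + es ! i]) ys = w e (ys ! i) * weight_product w es ys"
proof -
  have "(\<Prod>k\<in>{..<length es} - {i}. w (es[i := e + es ! i] ! k) (ys ! k)) =
      (\<Prod>k\<in>{..<length es} - {i}. w (es ! k) (ys ! k))"
    by (rule prod.cong) auto
  then show ?thesis
    using assms(2)
    by (simp add: weight_product_def prod.remove[of "{..<length es}" i] assms(1) mult.assoc)
qed

text \<open>
  The index \<open>y\<close> of the head runs over the complement of the indices of the tail. The sum over all
  \<open>y\<close> splits off as a factor, and the sum over \<open>y\<close> in the tail is a sum over positions, since the
  indices of the tail are distinct; there the exponents merge.
\<close>

lemma injective_sum_Cons:
  fixes w :: "'e::comm_monoid_add \<Rightarrow> 'i::finite \<Rightarrow> 'r::comm_ring_1"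
  assumes w_add: "\<And>e f y. w (e + f) y = w e y * w f y"
  shows "injective_sum w (e # es) =
    (\<Sum>y\<in>UNIV. w e y) * injective_sum w es -
    (\<Sum>i<length es. injective_sum w (es[i := e + es ! i]))"
proof -
  let ?L = "{ys :: 'i list. distinct ys \<and> length ys = length es}"
  let ?S = "SIGMA ys:?L. - set ys"
  have inner: "(\<Sum>y\<in>- set ys. w e y * weight_product w es ys) =
      (\<Sum>y\<in>UNIV. w e y) * weight_product w es ys -
      (\<Sum>i<length es. weight_product w (es[i := e + es ! i]) ys)" if "ys \<in> ?L" for ys
  proof -
    have ys: "distinct ys" "length ys = length es"
      using that by auto
    have "(\<Sum>y\<in>UNIV. w e y) = (\<Sum>y\<in>- set ys. w e y) + (\<Sum>y\<in>set ys. w e y)"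
      using sum.subset_diff[OF subset_UNIV[of "set ys"], of "w e"] by (simp add: Compl_eq_Diff_UNIV)
    moreover have "(\<Sum>y\<in>set ys. w e y) = (\<Sum>i<length es. w e (ys ! i))"
      using ys by (metis bij_betw_nth lessThan_iff sum.reindex_bij_betw)
    ultimately have "(\<Sum>y\<in>- set ys. w e y) = (\<Sum>y\<in>UNIV. w e y) - (\<Sum>i<length es. w e (ys ! i))"
      by simp
    then show ?thesis
      by (simp add: sum_distrib_right[symmetric] weight_product_merge[OF w_add] left_diff_distrib)
  qed
  have "injective_sum w (e # es) =
      (\<Sum>(ys, y)\<in>?S. weight_product w (e # es) (y # ys))"
    unfolding injective_sum_def
    by (rule sum.reindex_bij_witness[of _ "\<lambda>(ys, y). y # ys" "\<lambda>zs. (tl zs, hd zs)"])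
       (auto simp: length_Suc_conv)
  also have "\<dots> = (\<Sum>ys\<in>?L. \<Sum>y\<in>- set ys. w e y * weight_product w es ys)"
    by (subst sum.Sigma[symmetric])
       (simp_all add: finite_distinct_lists weight_product_def prod.lessThan_Suc_shift
          del: prod.lessThan_Suc)
  also have "\<dots> = (\<Sum>ys\<in>?L. (\<Sum>y\<in>UNIV. w e y) * weight_product w es ys -
      (\<Sum>i<length es. weight_product w (es[i := e + es ! i]) ys))"
    by (rule sum.cong) (simp_all only: inner)
  also have "\<dots> = (\<Sum>y\<in>UNIV. w e y) * injective_sum w es -
      (\<Sum>i<length es. injective_sum w (es[i := e + es ! i]))"
    by (simp add: injective_sum_def sum_subtractf sum_distrib_left sum.swap[of _ _ ?L])
  finally show ?thesis .
qed

section \<open>Reduction of power sums of high degree\<close>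

definition pair_monomial :: "nat \<times> nat \<Rightarrow> 'n \<Rightarrow> 'n bipolynomial" where
  "pair_monomial e j = z j ^ fst e * zbar j ^ snd e"

definition pair_degree :: "nat \<times> nat \<Rightarrow> nat" where
  "pair_degree e = fst e + snd e"

lemma pair_monomial_add: "pair_monomial (e + f) j = pair_monomial e j * pair_monomial f j"
  by (simp add: pair_monomial_def power_add algebra_simps)

lemma pair_degree_add: "pair_degree (e + f) = pair_degree e + pair_degree f"
  by (simp add: pair_degree_def)

lemma power_sum_eq: "\<tau> e = (\<Sum>j\<in>UNIV. pair_monomial e j)"
  by (simp add: power_sum_def pair_monomial_def case_prod_unfold)

lemma injective_sum_pair_Cons:
  "(injective_sum pair_monomial (e # es) :: 'n::finite bipolynomial) =
    \<tau> e * injective_sum pair_monomial es -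
    (\<Sum>i<length es. injective_sum pair_monomial (es[i := e + es ! i]))"
  unfolding power_sum_eq by (rule injective_sum_Cons) (rule pair_monomial_add)

lemma injective_sum_in_subalgebra:
  fixes G :: "'n::finite bipolynomial set"
  assumes G: "rational_subalgebra G" and \<tau>: "\<And>e. \<tau> e \<in> G"
  shows "injective_sum pair_monomial es \<in> G"
proof (induct "length es" arbitrary: es)
  case 0
  then show ?case
    by (simp add: injective_sum_Nil subalgebra_one[OF G])
next
  case (Suc k)
  then obtain e fs where es: "es = e # fs" "length fs = k"
    by (metis length_Suc_conv)
  show ?case
    unfolding es(1) injective_sum_pair_Cons
    by (intro subalgebra_diff[OF G] subalgebra_mult[OF G] subalgebra_sum[OF G] \<tau> Suc.hyps(1))
       (simp_all add: es(2))
qed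

lemma sum_list_merge:
  fixes es :: "'e::comm_monoid_add list"
  assumes "i < length es"
  shows "sum_list (es[i := e + es ! i]) = e + sum_list es"
  using assms
proof (induct es arbitrary: i)
  case (Cons a es)
  then show ?case
    by (cases i) (simp_all add: ac_simps)
qed simp

lemma pair_degree_sum_list_pos:
  assumes "es \<noteq> []" "\<forall>f\<in>set es. 0 < pair_degree f"
  shows "0 < pair_degree (sum_list es)"
  using assms by (cases es) (auto simp: pair_degree_add)

text \<open>
  Induction along the recursion for \<open>e # fs\<close>: both \<open>\<tau> e\<close> and the injective sum of \<open>fs\<close> involve only
  power sums of degree less than \<open>d\<close>, so their product lies in \<open>G\<close>. Each of the \<open>k + 1\<close> subtracted
  sums has the same total exponent and one entry less, hence by induction the leading coefficient
  \<open>(-1) ^ k * k!\<close>; together they give \<open>(-1) ^ (k + 1) * (k + 1)!\<close>.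
\<close>

lemma injective_sum_leading_term:
  fixes G :: "'n::finite bipolynomial set"
  assumes G: "rational_subalgebra G"
    and \<tau>: "\<And>e. 0 < pair_degree e \<Longrightarrow> pair_degree e < d \<Longrightarrow> \<tau> e \<in> G"
    and "length es = Suc k" "\<forall>f\<in>set es. 0 < pair_degree f" "pair_degree (sum_list es) \<le> d"
  shows "injective_sum pair_monomial es - (-1) ^ k * of_nat (fact k) * \<tau> (sum_list es) \<in> G"
  using assms(3-5)
proof (induct k arbitrary: es)
  case 0
  then obtain e where "es = [e]"
    by (auto simp: length_Suc_conv)
  then show ?case
    by (simp add: injective_sum_pair_Cons injective_sum_Nil subalgebra_zero[OF G])
next
  case (Suc k)
  then obtain e fs where es: "es = e # fs" "length fs = Suc k"
    by (metis length_Suc_conv)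
  have pos: "0 < pair_degree e" "\<forall>f\<in>set fs. 0 < pair_degree f"
    and deg: "pair_degree e + pair_degree (sum_list fs) \<le> d"
    using Suc.prems by (auto simp: es pair_degree_add)
  have fs_pos: "0 < pair_degree (sum_list fs)"
    using pair_degree_sum_list_pos[OF _ pos(2)] es(2) by fastforce
  let ?c = "(-1) ^ k * of_nat (fact k) :: 'n bipolynomial"
  let ?I = "injective_sum pair_monomial :: _ \<Rightarrow> 'n bipolynomial"
  have coeff: "?c \<in> G"
    using subalgebra_of_int[OF G, of "(-1) ^ k * fact k"] by simp
  have \<tau>_e: "\<tau> e \<in> G" and \<tau>_fs: "\<tau> (sum_list fs) \<in> G"
    using deg pos fs_pos by (auto intro!: \<tau>)
  have "?I fs - ?c * \<tau> (sum_list fs) \<in> G"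
    by (rule Suc.hyps) (use es(2) pos deg in auto)
  from subalgebra_add[OF G this subalgebra_mult[OF G coeff \<tau>_fs]]
  have I_fs: "?I fs \<in> G"
    by simp
  have merged: "?I (fs[i := e + fs ! i]) - ?c * \<tau> (e + sum_list fs) \<in> G" if "i < length fs" for i
  proof -
    have "?I (fs[i := e + fs ! i]) - ?c * \<tau> (sum_list (fs[i := e + fs ! i])) \<in> G"
    proof (rule Suc.hyps)
      show "\<forall>f\<in>set (fs[i := e + fs ! i]). 0 < pair_degree f"
        using set_update_subset_insert[of fs i "e + fs ! i"] pos by (auto simp: pair_degree_add)
    qed (use es(2) deg sum_list_merge[OF that, of e] in \<open>auto simp: pair_degree_add\<close>)
    then show ?thesis
      by (simp only: sum_list_merge[OF that])
  qed
  have "?I es - (-1) ^ Suc k * of_nat (fact (Suc k)) * \<tau> (sum_list es) =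
      \<tau> e * ?I fs - (\<Sum>i<length fs. ?I (fs[i := e + fs ! i]) - ?c * \<tau> (e + sum_list fs))"
    unfolding es(1) injective_sum_pair_Cons sum_subtractf
    by (simp add: es(2) algebra_simps)
  moreover have "(\<Sum>i<length fs. ?I (fs[i := e + fs ! i]) - ?c * \<tau> (e + sum_list fs)) \<in> G"
    by (rule subalgebra_sum[OF G]) (simp only: lessThan_iff merged)
  then have "\<tau> e * ?I fs - (\<Sum>i<length fs. ?I (fs[i := e + fs ! i]) - ?c * \<tau> (e + sum_list fs)) \<in> G"
    by (intro subalgebra_diff[OF G] subalgebra_mult[OF G] \<tau>_e I_fs)
  ultimately show ?case
    by simp
qed

lemma split_pair:
  assumes "Suc k \<le> pair_degree e"
  obtains es where "length es = Suc k" "\<forall>f\<in>set es. 0 < pair_degree f" "sum_list es = e"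
  using assms
proof (induct k arbitrary: e thesis)
  case 0
  then show ?case
    using 0(1)[of "[e]"] by simp
next
  case (Suc k)
  obtain u f where uf: "e = u + f" "pair_degree u = 1"
  proof (cases "fst e")
    case 0
    with Suc.prems(2) show ?thesis
      using that[of "(0, 1)" "(0, snd e - 1)"] by (cases e) (auto simp: pair_degree_def)
  next
    case (Suc r)
    then show ?thesis
      using that[of "(1, 0)" "(r, snd e)"] by (cases e) (auto simp: pair_degree_def)
  qed
  with Suc.prems(2) have "Suc k \<le> pair_degree f"
    by (simp add: pair_degree_add)
  then obtain es where "length es = Suc k" "\<forall>f\<in>set es. 0 < pair_degree f" "sum_list es = f"
    using Suc.hyps by blast
  then show ?case
    using Suc.prems(1)[of "u # es"] uf by simp
qed

text \<open>
  Induction on the degree. Beyond degree \<open>n\<close>, split \<open>e\<close> into \<open>n + 1\<close> pairs of positive degree: their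
  injective sum vanishes by the pigeonhole principle, which leaves \<open>n! * \<tau> e\<close> in terms of smaller
  degrees.
\<close>

lemma all_power_sums_in_subalgebra:
  fixes G :: "'n::finite bipolynomial set"
  assumes G: "rational_subalgebra G"
    and gen: "\<And>e. e \<in> generator_indices CARD('n) \<Longrightarrow> \<tau> e \<in> G"
  shows "\<tau> e \<in> G"
proof (induct "pair_degree e" arbitrary: e rule: less_induct)
  case less
  consider "pair_degree e = 0" | "e \<in> generator_indices CARD('n)" | "CARD('n) < pair_degree e"
    by (cases e) (fastforce simp: pair_degree_def generator_indices_def)
  then show ?case
  proof cases
    \<comment> \<open>The power sum of degree \<open>0\<close> is the constant \<open>n\<close>.\<close>
    case 1
    then have "\<tau> e = (of_nat CARD('n) :: 'n bipolynomial)"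
      by (simp add: pair_degree_def power_sum_eq pair_monomial_def)
    then show ?thesis
      by (simp only: subalgebra_of_nat[OF G])
  next
    case 2
    then show ?thesis
      by (rule gen)
  next
    case 3
    then obtain es where es: "length es = Suc CARD('n)" "\<forall>f\<in>set es. 0 < pair_degree f"
      "sum_list es = e"
      using split_pair[of "CARD('n)" e] by auto
    have "injective_sum pair_monomial es - (-1) ^ CARD('n) * of_nat (fact CARD('n)) * \<tau> (sum_list es)
        \<in> G"
      by (rule injective_sum_leading_term[OF G _ es(1,2), where d = "pair_degree e"]) (use less es(3) in auto)
    then have "- ((-1) ^ CARD('n) * of_nat (fact CARD('n)) * \<tau> e) \<in> G"
      by (simp add: injective_sum_too_long es)
    \<comment> \<open>The sign is its own inverse.\<close>
    from subalgebra_mult[OF G subalgebra_of_int[OF G, of "- ((-1) ^ CARD('n))"] this]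
    have "of_nat (fact CARD('n)) * \<tau> e \<in> G"
      by (simp add: mult.assoc[symmetric] power_add[symmetric] del: of_nat_fact)
    then show ?thesis
      by (rule subalgebra_divide[OF G]) simp
  qed
qed

section \<open>Bisymmetric functions\<close>

lemma prod_bivariable:
  fixes f :: "'n::finite bivariable \<Rightarrow> 'r::comm_monoid_mult"
  shows "(\<Prod>v\<in>range Z \<union> range Zbar. f v) = (\<Prod>j\<in>UNIV. f (Z j) * f (Zbar j))"
proof -
  have "(\<Prod>v\<in>range Z \<union> range Zbar. f v) = (\<Prod>v\<in>range Z. f v) * (\<Prod>v\<in>range Zbar. f v)"
    by (rule prod.union_disjoint) auto
  then show ?thesis
    by (simp add: prod.reindex inj_on_def prod.distrib)
qed

lemma diagonal_action_single:
  fixes \<sigma> :: "'n::finite \<Rightarrow> 'n"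
  shows "diagonal_action \<sigma> (Poly_Mapping.single m c) =
    scalar c * (\<Prod>j\<in>UNIV.
      pair_monomial (Poly_Mapping.lookup m (Z j), Poly_Mapping.lookup m (Zbar j)) (\<sigma> j))"
proof -
  have "Poly_Mapping.keys m \<subseteq> range Z \<union> range Zbar"
    by (metis UnCI bivariable.exhaust rangeI subsetI)
  then show ?thesis
    by (simp add: diagonal_action_def coefficient_hom.substitute_single[OF coefficient_hom_scalar]
        eval_monomial_superset[of "range Z \<union> range Zbar"] prod_bivariable pair_monomial_def)
qed

lemma diagonal_action_pair_monomial:
  "diagonal_action \<sigma> (pair_monomial e j) = pair_monomial e (\<sigma> j)"
  by (simp add: diagonal_action_def pair_monomial_def
      coefficient_hom.substitute_mult[OF coefficient_hom_scalar]
      coefficient_hom.substitute_power[OF coefficient_hom_scalar]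
      coefficient_hom.substitute_variable[OF coefficient_hom_scalar])

lemma diagonal_action_sum:
  "diagonal_action \<sigma> (\<Sum>i\<in>I. p i) = (\<Sum>i\<in>I. diagonal_action \<sigma> (p i))"
  by (simp add: diagonal_action_def coefficient_hom.substitute_sum[OF coefficient_hom_scalar])

lemma diagonal_action_power_sum:
  assumes "bij \<sigma>"
  shows "diagonal_action \<sigma> (\<tau> e) = \<tau> e"
  using sum.reindex_bij_betw[OF assms, of "pair_monomial e"]
  by (simp add: power_sum_eq diagonal_action_sum diagonal_action_pair_monomial)

lemma rational_coefficients_mult:
  fixes p q :: "('v, complex) polynomial"
  assumes "\<And>m. Poly_Mapping.lookup p m \<in> \<rat>" "\<And>m. Poly_Mapping.lookup q m \<in> \<rat>"
  shows "Poly_Mapping.lookup (p * q) m \<in> \<rat>"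
proof -
  have "p * q = (\<Sum>a\<in>Poly_Mapping.keys p. Poly_Mapping.single a (Poly_Mapping.lookup p a)) *
      (\<Sum>b\<in>Poly_Mapping.keys q. Poly_Mapping.single b (Poly_Mapping.lookup q b))"
    by (rule arg_cong2[where f = "(*)"]) (rule polynomial_as_sum_of_monomials)+
  also have "\<dots> = (\<Sum>a\<in>Poly_Mapping.keys p. \<Sum>b\<in>Poly_Mapping.keys q.
      Poly_Mapping.single (a + b) (Poly_Mapping.lookup p a * Poly_Mapping.lookup q b))"
    by (simp add: sum_product mult_single)
  finally have product: "p * q = \<dots>" .
  show ?thesis
    unfolding product lookup_sum lookup_single
    by (intro Rats_sum) (simp add: when_def assms)
qed

lemma rational_coefficients_power:
  fixes p :: "('v, complex) polynomial"
  assumes "\<And>m. Poly_Mapping.lookup p m \<in> \<rat>"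
  shows "Poly_Mapping.lookup (p ^ k) m \<in> \<rat>"
proof (induct k arbitrary: m)
  case 0
  show ?case
    by (simp add: lookup_one when_def)
next
  case (Suc k)
  show ?case
    unfolding power_Suc by (rule rational_coefficients_mult[OF assms Suc])
qed

lemma power_sum_bisymmetric: "(\<tau> e :: 'n::finite bipolynomial) \<in> bisymmetric"
proof -
  have "Poly_Mapping.lookup (variable v :: ('v, complex) polynomial) m \<in> \<rat>" for v m
    by (simp add: variable_def lookup_single when_def)
  then have "Poly_Mapping.lookup (\<tau> e :: 'n bipolynomial) m \<in> \<rat>" for m
    unfolding power_sum_eq pair_monomial_def lookup_sum
    by (intro Rats_sum rational_coefficients_mult rational_coefficients_power)
  then show ?thesis
    by (simp add: bisymmetric_def diagonal_action_power_sum)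
qed

lemma rational_subalgebra_bisymmetric: "rational_subalgebra bisymmetric"
  unfolding rational_subalgebra_def
proof (intro conjI allI ballI)
  fix c
  show "scalar (of_rat c) \<in> bisymmetric"
    by (simp add: bisymmetric_def diagonal_action_def
        coefficient_hom.substitute_scalar[OF coefficient_hom_scalar])
       (simp add: scalar_def lookup_single when_def)
next
  fix p q :: "'a bipolynomial"
  assume pq: "p \<in> bisymmetric" "q \<in> bisymmetric"
  then show "p + q \<in> bisymmetric"
    by (simp add: bisymmetric_def diagonal_action_def lookup_add
        coefficient_hom.substitute_add[OF coefficient_hom_scalar])
  have "Poly_Mapping.lookup (p * q) m \<in> \<rat>" for m
    by (rule rational_coefficients_mult) (use pq in \<open>simp_all add: bisymmetric_def\<close>)
  with pq show "p * q \<in> bisymmetric"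
    by (simp add: bisymmetric_def diagonal_action_def
        coefficient_hom.substitute_mult[OF coefficient_hom_scalar])
qed

text \<open>
  A permutation is determined by the list of its values along a fixed enumeration of the indices,
  and on a finite type every distinct list of full length arises in this way.
\<close>

lemma sum_permutations_eq_injective_sum:
  fixes w :: "'e \<Rightarrow> 'i::finite \<Rightarrow> 'r::comm_ring_1"
  assumes js: "distinct js" "set js = (UNIV :: 'i set)"
  shows "(\<Sum>\<sigma> | bij \<sigma>. \<Prod>j\<in>UNIV. w (e j) (\<sigma> j)) = injective_sum w (map e js)"
proof -
  have weight: "(\<Prod>j\<in>UNIV. w (e j) (\<sigma> j)) = weight_product w (map e js) (map \<sigma> js)" for \<sigma> :: "'i \<Rightarrow> 'i"
    using prod.reindex_bij_betw[OF bij_betw_nth[OF js(1) refl refl], of "\<lambda>j. w (e j) (\<sigma> j)"] js(2)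
    by (simp add: weight_product_def)
  have "bij_betw (\<lambda>\<sigma>. map \<sigma> js) {\<sigma> :: 'i \<Rightarrow> 'i. bij \<sigma>} {ys. distinct ys \<and> length ys = length js}"
  proof (intro bij_betw_imageI inj_onI set_eqI iffI)
    fix \<sigma> \<rho> :: "'i \<Rightarrow> 'i"
    assume "map \<sigma> js = map \<rho> js"
    then show "\<sigma> = \<rho>"
      by (simp add: map_eq_conv js(2) fun_eq_iff)
  next
    fix ys :: "'i list"
    assume "ys \<in> (\<lambda>\<sigma>. map \<sigma> js) ` {\<sigma>. bij \<sigma>}"
    then show "ys \<in> {ys. distinct ys \<and> length ys = length js}"
      using js by (auto simp: distinct_map bij_def)
  next
    fix ys :: "'i list"
    assume "ys \<in> {ys. distinct ys \<and> length ys = length js}"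
    then have ys: "distinct ys" "length js = length ys"
      by auto
    let ?\<sigma> = "\<lambda>j. the (map_of (zip js ys) j)"
    have map: "map ?\<sigma> js = ys"
      using ys js(1) by (intro nth_equalityI) (simp_all add: map_of_zip_nth)
    have "distinct (map ?\<sigma> js)"
      unfolding map by (rule ys(1))
    then have "inj ?\<sigma>"
      unfolding distinct_map js(2) by blast
    then have "bij ?\<sigma>"
      by (simp add: bij_def finite_UNIV_inj_surj)
    then show "ys \<in> (\<lambda>\<sigma>. map \<sigma> js) ` {\<sigma>. bij \<sigma>}"
      using map by (intro image_eqI[of _ _ ?\<sigma>]) auto
  qed
  from sum.reindex_bij_betw[OF this, of "weight_product w (map e js)"] show ?thesis
    by (simp add: weight injective_sum_def)
qed

text \<open>
  The Reynolds operator: an invariant polynomial is, up to the number of permutations, the sum of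
  its images, and the sum of the images of a monomial is an injective sum.
\<close>

lemma bisymmetric_in_subalgebra:
  fixes G :: "'n::finite bipolynomial set"
  assumes G: "rational_subalgebra G" and \<tau>: "\<And>e. \<tau> e \<in> G" and p: "p \<in> bisymmetric"
  shows "p \<in> G"
proof -
  obtain js :: "'n list" where js: "distinct js" "set js = UNIV"
    using finite_distinct_list[OF finite[of UNIV]] by blast
  let ?P = "{\<sigma> :: 'n \<Rightarrow> 'n. bij \<sigma>}"
  let ?e = "\<lambda>m j. (Poly_Mapping.lookup m (Z j), Poly_Mapping.lookup m (Zbar j))"
  let ?c = "\<lambda>m. scalar (Poly_Mapping.lookup p m)"
  have expand: "diagonal_action \<sigma> p =
      (\<Sum>m\<in>Poly_Mapping.keys p. ?c m * (\<Prod>j\<in>UNIV. pair_monomial (?e m j) (\<sigma> j)))" for \<sigma>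
    using arg_cong[OF polynomial_as_sum_of_monomials[of p], of "diagonal_action \<sigma>"]
    unfolding diagonal_action_sum diagonal_action_single .
  have "of_nat (card ?P) * p = (\<Sum>\<sigma>\<in>?P. diagonal_action \<sigma> p)"
    using p by (simp add: bisymmetric_def)
  also have "\<dots> = (\<Sum>\<sigma>\<in>?P. \<Sum>m\<in>Poly_Mapping.keys p. ?c m * (\<Prod>j\<in>UNIV. pair_monomial (?e m j) (\<sigma> j)))"
    by (simp only: expand)
  also have "\<dots> = (\<Sum>m\<in>Poly_Mapping.keys p. ?c m *
      (\<Sum>\<sigma>\<in>?P. \<Prod>j\<in>UNIV. pair_monomial (?e m j) (\<sigma> j)))"
    by (subst sum.swap) (simp only: sum_distrib_left)
  also have "\<dots> = (\<Sum>m\<in>Poly_Mapping.keys p. ?c m * injective_sum pair_monomial (map (?e m) js))"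
    by (intro sum.cong refl arg_cong2[where f = "(*)"])
       (rule sum_permutations_eq_injective_sum[OF js, of pair_monomial])
  also have "\<dots> \<in> G"
  proof (intro subalgebra_sum[OF G] subalgebra_mult[OF G] injective_sum_in_subalgebra[OF G \<tau>])
    fix m
    have "Poly_Mapping.lookup p m \<in> \<rat>"
      using p by (simp add: bisymmetric_def)
    then show "?c m \<in> G"
      using subalgebra_scalar[OF G] by (metis Rats_cases)
  qed
  finally have "of_nat (card ?P) * p \<in> G" .
  moreover have "id \<in> ?P"
    by simp
  then have "card ?P \<noteq> 0"
    by (metis card_0_eq empty_iff finite)
  ultimately show ?thesis
    by (rule subalgebra_divide[OF G])
qed

lemma indets_add: "indets (p + q) \<subseteq> indets p \<union> indets (q :: ('v, 'c::comm_ring_1) polynomial)"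
  using keys_add[of p q] by (auto simp: indets_def)

lemma indets_mult: "indets (p * q) \<subseteq> indets p \<union> indets (q :: ('v, 'c::comm_ring_1) polynomial)"
proof
  fix v
  assume "v \<in> indets (p * q)"
  then obtain m where "m \<in> Poly_Mapping.keys (p * q)" "v \<in> Poly_Mapping.keys m"
    by (auto simp: indets_def)
  then obtain a b where "a \<in> Poly_Mapping.keys p" "b \<in> Poly_Mapping.keys q"
    "v \<in> Poly_Mapping.keys (a + b)"
    using keys_mult[of p q] by blast
  then show "v \<in> indets p \<union> indets q"
    using keys_add[of a b] by (auto simp: indets_def)
qed

lemma rational_subalgebra_generated:
  "rational_subalgebra {p :: 'n::finite bipolynomial. polynomial_in_generators p}"
  (is "rational_subalgebra ?G")
  unfolding rational_subalgebra_def
proof (intro conjI allI ballI)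
  fix c
  show "scalar (of_rat c) \<in> ?G"
    unfolding mem_Collect_eq polynomial_in_generators_def
  proof (intro exI conjI)
    show "indets (scalar c :: (nat \<times> nat, rat) polynomial) \<subseteq> generator_indices CARD('n)"
      by (auto simp: indets_def scalar_def split: if_splits)
    show "scalar (of_rat c) = substitute (\<lambda>c. scalar (of_rat c)) \<tau> (scalar c)"
      by (simp only: coefficient_hom.substitute_scalar[OF coefficient_hom_scalar_of_rat])
  qed
next
  fix p q
  assume "p \<in> ?G" "q \<in> ?G"
  then obtain F H :: "(nat \<times> nat, rat) polynomial" where FH:
    "indets F \<subseteq> generator_indices CARD('n)" "p = substitute (\<lambda>c. scalar (of_rat c)) \<tau> F"
    "indets H \<subseteq> generator_indices CARD('n)" "q = substitute (\<lambda>c. scalar (of_rat c)) \<tau> H"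
    by (auto simp: polynomial_in_generators_def)
  then show "p + q \<in> ?G"
    using indets_add[of F H]
    by (auto simp: polynomial_in_generators_def intro!: exI[of _ "F + H"]
        coefficient_hom.substitute_add[OF coefficient_hom_scalar_of_rat, symmetric])
  show "p * q \<in> ?G"
    using FH indets_mult[of F H]
    by (auto simp: polynomial_in_generators_def intro!: exI[of _ "F * H"]
        coefficient_hom.substitute_mult[OF coefficient_hom_scalar_of_rat, symmetric])
qed

lemma generator_in_generated:
  assumes "e \<in> generator_indices CARD('n)"
  shows "polynomial_in_generators (\<tau> e :: 'n::finite bipolynomial)"
  unfolding polynomial_in_generators_def
proof (intro exI conjI)
  show "indets (variable e :: (nat \<times> nat, rat) polynomial) \<subseteq> generator_indices CARD('n)"
    using assms by (auto simp: indets_def variable_def)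
  show "\<tau> e = substitute (\<lambda>c. scalar (of_rat c)) \<tau> (variable e)"
    by (simp only: coefficient_hom.substitute_variable[OF coefficient_hom_scalar_of_rat])
qed

section \<open>The bracket of two power sums\<close>

text \<open>
  The factor \<open>c\<close> is the logarithmic derivative of \<open>x\<close>. It is a ring element and need not be a
  constant.
\<close>

lemma derivation_power:
  fixes D :: "'r::comm_ring_1 \<Rightarrow> 'r"
  assumes leibniz: "\<And>p q. D (p * q) = D p * q + p * D q" and x: "D x = c * x"
  shows "D (x ^ k) = of_nat k * c * x ^ k"
proof (induct k)
  case 0
  show ?case
    using leibniz[of 1 1] by simp
next
  case (Suc k)
  then show ?case
    by (simp add: leibniz x algebra_simps)
qed

lemma derivation_pair_monomial:
  assumes "\<And>p q. D (p * q) = D p * q + p * D q"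
    and "D (z j) = c * z j" "D (zbar j) = d * zbar j"
  shows "D (pair_monomial e j) = (of_nat (fst e) * c + of_nat (snd e) * d) * pair_monomial e j"
  by (simp add: pair_monomial_def assms(1) derivation_power[of D, OF assms(1,2)]
      derivation_power[of D, OF assms(1,3)] algebra_simps)

text \<open>
  The monomial of index \<open>j\<close> is first bracketed with the variables of index \<open>k\<close> and then with a
  monomial in them, so that the logarithmic derivative rule is used once in each argument.
\<close>

lemma scaled_torus_bracket_power_sums:
  fixes br :: "'n::finite bipolynomial \<Rightarrow> 'n bipolynomial \<Rightarrow> 'n bipolynomial"
  assumes br: "torus_poisson_bracket br"
  shows "scalar (\<i> / 2) * br (\<tau> e) (\<tau> f) =
    of_int (int (fst e) * int (snd f) - int (fst f) * int (snd e)) * \<tau> (e + f)"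
proof -
  define D where "D p q = scalar (\<i> / 2) * br p q" for p q
  have br_add: "br (p + q) r = br p r + br q r"
    and br_swap: "br p q = - br q p"
    and br_leibniz: "br p (q * r) = br p q * r + q * br p r" for p q r
    using br unfolding torus_poisson_bracket_def poisson_bracket_def by blast+
  have add_left: "D (p + q) r = D p r + D q r"
    and leibniz_right: "D p (q * r) = D p q * r + q * D p r" for p q r
    by (simp_all add: D_def br_add br_leibniz algebra_simps)
  have swap: "D p q = - D q p" for p q
    unfolding D_def by (subst br_swap) (rule mult_minus_right)
  have leibniz_left: "D (p * q) r = D p r * q + p * D q r" for p q r
    using swap[of "p * q" r] swap[of p r] swap[of q r] leibniz_right[of r p q] by simp
  have add_right: "D r (p + q) = D r p + D r q" for p q r
    using swap[of r "p + q"] swap[of r p] swap[of r q] add_left[of p q r] by simp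
  have sum_left: "D (\<Sum>j\<in>I. p j) r = (\<Sum>j\<in>I. D (p j) r)" for I r and p :: "'n \<Rightarrow> _"
    using add_left[of 0 0 r] by (induct I rule: infinite_finite_induct) (simp_all add: add_left)
  have sum_right: "D r (\<Sum>j\<in>I. p j) = (\<Sum>j\<in>I. D r (p j))" for I r and p :: "'n \<Rightarrow> _"
    using add_right[of r 0 0] by (induct I rule: infinite_finite_induct) (simp_all add: add_right)
  have zz: "D (z j) (z k) = 0 * z j" "D (zbar j) (zbar k) = 0 * zbar j"
    and zzbar: "D (z j) (zbar k) = of_bool (j = k) * zbar k * z j" for j k
    using br by (auto simp: D_def torus_poisson_bracket_def)
  have zbarz: "D (zbar j) (z k) = - of_bool (j = k) * z k * zbar j" for j k
    using swap[of "zbar j" "z k"] zzbar[of k j] by simp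
  \<comment> \<open>With the variable of index \<open>k\<close> split off on the right, the cofactors are the logarithmic
    derivatives of \<open>z k\<close> and \<open>zbar k\<close> for the bracket with \<open>pair_monomial e j\<close>.\<close>
  have mz: "D (pair_monomial e j) (z k) =
      (- of_bool (j = k) * of_nat (snd e) * pair_monomial e j) * z k" for j k
    using derivation_pair_monomial[of "\<lambda>p. D p (z k)", OF leibniz_left zz(1) zbarz, where e = e]
    by (simp add: algebra_simps)
  have mzbar: "D (pair_monomial e j) (zbar k) =
      (of_bool (j = k) * of_nat (fst e) * pair_monomial e j) * zbar k" for j k
    using derivation_pair_monomial[of "\<lambda>p. D p (zbar k)", OF leibniz_left zzbar zz(2), where e = e]
    by (simp add: algebra_simps)
  let ?c = "int (fst e) * int (snd f) - int (fst f) * int (snd e)"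
  have mm: "D (pair_monomial e j) (pair_monomial f k) =
      (if j = k then of_int ?c * pair_monomial (e + f) j else 0)" for j k
  proof -
    have "D (pair_monomial e j) (pair_monomial f k) =
        (of_nat (fst f) * (- of_bool (j = k) * of_nat (snd e) * pair_monomial e j) +
         of_nat (snd f) * (of_bool (j = k) * of_nat (fst e) * pair_monomial e j)) *
        pair_monomial f k"
      by (rule derivation_pair_monomial) (rule leibniz_right mz mzbar)+
    then show ?thesis
      by (auto simp: pair_monomial_add algebra_simps)
  qed
  have "D (\<tau> e) (\<tau> f) = (\<Sum>j\<in>UNIV. \<Sum>k\<in>UNIV. D (pair_monomial e j) (pair_monomial f k))"
    by (simp only: power_sum_eq sum_left) (simp only: sum_right)
  also have "\<dots> = of_int ?c * \<tau> (e + f)"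
    unfolding mm by (simp add: power_sum_eq sum_distrib_left)
  finally show ?thesis
    by (simp only: D_def)
qed

theorem theorem3p4p2:
  fixes br :: "'n::finite bipolynomial \<Rightarrow> 'n bipolynomial \<Rightarrow> 'n bipolynomial"
  assumes "torus_poisson_bracket br"
  shows "(bisymmetric :: 'n bipolynomial set) = {p. polynomial_in_generators p} \<and>
    (\<forall>(j\<^sub>1, k\<^sub>1) \<in> generator_indices CARD('n). \<forall>(j\<^sub>2, k\<^sub>2) \<in> generator_indices CARD('n).
      scalar (\<i> / 2) * br (\<tau> (j\<^sub>1, k\<^sub>1)) (\<tau> (j\<^sub>2, k\<^sub>2)) =
        of_int (int j\<^sub>1 * int k\<^sub>2 - int j\<^sub>2 * int k\<^sub>1) * \<tau> (j\<^sub>1 + j\<^sub>2, k\<^sub>1 + k\<^sub>2) \<and>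
      (j\<^sub>1 + j\<^sub>2 + k\<^sub>1 + k\<^sub>2 > CARD('n) \<longrightarrow>
        polynomial_in_generators
          (of_int (int j\<^sub>1 * int k\<^sub>2 - int j\<^sub>2 * int k\<^sub>1) * \<tau> (j\<^sub>1 + j\<^sub>2, k\<^sub>1 + k\<^sub>2) :: 'n bipolynomial)))"
proof -
  let ?G = "{p :: 'n bipolynomial. polynomial_in_generators p}"
  have \<tau>: "\<tau> e \<in> ?G" for e
    by (rule all_power_sums_in_subalgebra[OF rational_subalgebra_generated])
       (simp add: generator_in_generated)
  have "bisymmetric = ?G"
  proof (intro subset_antisym subsetI)
    fix p :: "'n bipolynomial"
    assume "p \<in> bisymmetric"
    then show "p \<in> ?G"
      by (rule bisymmetric_in_subalgebra[OF rational_subalgebra_generated \<tau>])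
  next
    fix p :: "'n bipolynomial"
    assume "p \<in> ?G"
    then show "p \<in> bisymmetric"
      by (auto simp: polynomial_in_generators_def
          intro!: substitute_in_subalgebra[OF rational_subalgebra_bisymmetric] power_sum_bisymmetric)
  qed
  moreover have "polynomial_in_generators (of_int c * \<tau> e :: 'n bipolynomial)" for c e
    using subalgebra_mult[OF rational_subalgebra_generated
        subalgebra_of_int[OF rational_subalgebra_generated] \<tau>] by simp
  ultimately show ?thesis
    by (auto simp: scaled_torus_bracket_power_sums[OF assms] simp del: of_int_diff of_int_mult)
qed

end
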